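(* Let $d\ge1$ and let $\zeta$ be the zeta function of the poset $P_d^\times$: $\zeta(x,y)=1$ if $x\preceq y$ and $\zeta(x,y)=0$ otherwise. Index the witness incidence matrix $A$ by $P_d^\times$ (via the bijection between $P_d^\times$ and $\mathcal G_d$). Then $A_{x,y}=\zeta(x,y)$ for all $x,y\in P_d^\times$. Equivalently, if the weights $w$ and the complete signed tail family $\lambda=Aw$ are viewed as functions on $P_d^\times$, then $$\lambda(x)=\sum_{y\succeq x}w(y).$$
   Context: $[d]=\{1,\dots,d\}$. Let $E=\{\mathrm M,\mathrm L,\mathrm U\}$ with the partial order $\mathrm M\prec\mathrm L$, $\mathrm M\prec\mathrm U$, and $\mathrm L,\mathrm U$ incomparable. $P_d=E^d$ carries the product order $\preceq$, and $P_d^\times=P_d\setminus\{(\mathrm M,\dots,\mathrm M)\}$ the induced order. $\mathcal G_d=\{(I,\sigma):\emptyset\ne I\subseteq[d],\ \sigma\in\{\mathrm L,\mathrm U\}^I\}$, where $\{\mathrm L,\mathrm U\}^I$ is the set of functions $I\to\{\mathrm L,\mathrm U\}$. The bijection $\mathcal G_d\to P_d^\times$ sends $(I,\sigma)$ to the $x$ with $x_i=\sigma_i$ for $i\in I$ and $x_i=\mathrm M$ for $i\notin I$. The witness incidence matrix $A$, with rows and columns indexed by $\mathcal G_d$, has entries $A_{(J,\tau),(I,\sigma)}=\mathbf 1\{J\subseteq I,\ \sigma|_J=\tau\}$. *)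

theory Defs
  imports Complex_Main "HOL-Library.FuncSet"
begin

datatype label = M | L | U

instantiation label :: order
begin

definition less_eq_label :: "label \<Rightarrow> label \<Rightarrow> bool"
  where "x \<le> y \<longleftrightarrow> x = y \<or> x = M"

definition less_label :: "label \<Rightarrow> label \<Rightarrow> bool"
  where "x < y \<longleftrightarrow> x = M \<and> y \<noteq> M"

instance
  by standard (auto simp: less_eq_label_def less_label_def)

end

text \<open>Elements of \<open>E\<^sup>d\<close> are extensional functions: they take the value \<^const>\<open>undefined\<close>
  outside \<open>{1..d}\<close>.\<close>

definition P :: "nat \<Rightarrow> (nat \<Rightarrow> label) set"
  where "P d = {1..d} \<rightarrow>\<^sub>E UNIV"

definition preceq :: "nat \<Rightarrow> (nat \<Rightarrow> label) \<Rightarrow> (nat \<Rightarrow> label) \<Rightarrow> bool"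
  where "preceq d x y \<longleftrightarrow> (\<forall>i\<in>{1..d}. x i \<le> y i)"

definition P_times :: "nat \<Rightarrow> (nat \<Rightarrow> label) set"
  where "P_times d = P d - {\<lambda>i\<in>{1..d}. M}"

definition zeta :: "('a \<Rightarrow> 'a \<Rightarrow> bool) \<Rightarrow> 'a \<Rightarrow> 'a \<Rightarrow> real"
  where "zeta le x y = (if le x y then 1 else 0)"

type_synonym signed_set = "nat set \<times> (nat \<Rightarrow> label)"

definition G :: "nat \<Rightarrow> signed_set set"
  where "G d = {(I, \<sigma>). I \<noteq> {} \<and> I \<subseteq> {1..d} \<and> \<sigma> \<in> I \<rightarrow>\<^sub>E {L, U}}"

definition to_P :: "nat \<Rightarrow> signed_set \<Rightarrow> nat \<Rightarrow> label"
  where "to_P d = (\<lambda>(I, \<sigma>). \<lambda>i\<in>{1..d}. if i \<in> I then \<sigma> i else M)"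

lemma bij_betw_to_P: "bij_betw (to_P d) (G d) (P_times d)"
proof (rule bij_betw_byWitness
    [where f' = "\<lambda>x. let I = {i\<in>{1..d}. x i \<noteq> M} in (I, restrict x I)"])
  show "\<forall>a\<in>G d. (let I = {i\<in>{1..d}. to_P d a i \<noteq> M} in (I, restrict (to_P d a) I)) = a"
  proof
    fix a assume "a \<in> G d"
    then obtain I \<sigma> where a: "a = (I, \<sigma>)" "I \<subseteq> {1..d}" "\<sigma> \<in> I \<rightarrow>\<^sub>E {L, U}"
      by (auto simp: G_def)
    have "\<sigma> i \<noteq> M" if "i \<in> I" for i
      using PiE_mem[OF a(3) that] by auto
    then have I: "{i\<in>{1..d}. to_P d a i \<noteq> M} = I"
      using a(1,2) by (auto simp: to_P_def)
    have "restrict (to_P d a) I = \<sigma>"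
      using a by (auto simp: to_P_def fun_eq_iff restrict_def PiE_def extensional_def)
    with I a(1) show "(let I = {i\<in>{1..d}. to_P d a i \<noteq> M} in (I, restrict (to_P d a) I)) = a"
      by (simp add: Let_def)
  qed
  show "\<forall>x\<in>P_times d. to_P d (let I = {i\<in>{1..d}. x i \<noteq> M} in (I, restrict x I)) = x"
    by (auto simp: P_times_def P_def to_P_def fun_eq_iff PiE_def extensional_def restrict_def)
  show "to_P d ` G d \<subseteq> P_times d"
  proof
    fix x assume "x \<in> to_P d ` G d"
    then obtain I \<sigma> where *: "x = to_P d (I, \<sigma>)" "I \<noteq> {}" "I \<subseteq> {1..d}" "\<sigma> \<in> I \<rightarrow>\<^sub>E {L, U}"
      by (auto simp: G_def)
    then obtain i where i: "i \<in> I" by blast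
    have "\<sigma> i \<noteq> M" using PiE_mem[OF *(4) i] by auto
    then have "x i \<noteq> M" "i \<in> {1..d}" using * i by (auto simp: to_P_def)
    then have "x \<noteq> (\<lambda>i\<in>{1..d}. M)" by (metis restrict_apply')
    then show "x \<in> P_times d" using *(1) by (simp add: P_times_def P_def to_P_def)
  qed
  show "(\<lambda>x. let I = {i\<in>{1..d}. x i \<noteq> M} in (I, restrict x I)) ` P_times d \<subseteq> G d"
  proof
    fix a assume "a \<in> (\<lambda>x. let I = {i\<in>{1..d}. x i \<noteq> M} in (I, restrict x I)) ` P_times d"
    then obtain x where x: "x \<in> P_times d"
      and a: "a = ({i\<in>{1..d}. x i \<noteq> M}, restrict x {i\<in>{1..d}. x i \<noteq> M})"
      by (auto simp: Let_def)
    have "{i\<in>{1..d}. x i \<noteq> M} \<noteq> {}"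
    proof
      assume "{i\<in>{1..d}. x i \<noteq> M} = {}"
      then have "x i = M" if "i \<in> {1..d}" for i
        using that by blast
      moreover have "x \<in> extensional {1..d}"
        using x by (simp add: P_times_def P_def PiE_def)
      ultimately have "x = (\<lambda>i\<in>{1..d}. M)"
        by (intro extensionalityI[of x "{1..d}"]) auto
      with x show False by (simp add: P_times_def)
    qed
    moreover have "x i \<in> {L, U}" if "x i \<noteq> M" for i
      using that by (cases "x i") auto
    ultimately show "a \<in> G d" unfolding a G_def by auto
  qed
qed

definition of_P :: "nat \<Rightarrow> (nat \<Rightarrow> label) \<Rightarrow> signed_set"
  where "of_P d = inv_into (G d) (to_P d)"

definition fun_on_P :: "nat \<Rightarrow> (signed_set \<Rightarrow> real) \<Rightarrow> (nat \<Rightarrow> label) \<Rightarrow> real"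
  where "fun_on_P d f x = f (of_P d x)"

definition matrix_on_P ::
    "nat \<Rightarrow> (signed_set \<Rightarrow> signed_set \<Rightarrow> real) \<Rightarrow> (nat \<Rightarrow> label) \<Rightarrow> (nat \<Rightarrow> label) \<Rightarrow> real"
  where "matrix_on_P d B x y = B (of_P d x) (of_P d y)"

text \<open>The first argument is the row index; only indices in \<open>G d\<close> matter.\<close>

definition witness_matrix :: "signed_set \<Rightarrow> signed_set \<Rightarrow> real"
  where "witness_matrix = (\<lambda>(J, \<tau>) (I, \<sigma>). if J \<subseteq> I \<and> restrict \<sigma> J = \<tau> then 1 else 0)"

definition tail_family :: "nat \<Rightarrow> (signed_set \<Rightarrow> real) \<Rightarrow> signed_set \<Rightarrow> real"
  where "tail_family d w g = (\<Sum>h\<in>G d. witness_matrix g h * w h)"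

end

theory Submission
  imports Defs
begin

text \<open>Under the bijection from signed sets to \<^term>\<open>P_times d\<close>, the support of a signed set
  becomes the set of coordinates with a label other than \<^const>\<open>M\<close>. A coordinate labelled
  \<^const>\<open>M\<close> lies below every label, and a coordinate labelled \<^const>\<open>L\<close> or
  \<^const>\<open>U\<close> lies only below itself. Hence one point precedes another exactly when the second
  agrees with the first on the support of the first, which is the condition that the supports are
  nested and the signs agree: the two indicator matrices coincide (\<open>witness_matrix_eq_zeta\<close>).
  The formula for the tail family is then the product of this matrix with a weight vector, with
  the sum transported along the bijection and its vanishing terms dropped.\<close>

text \<open>The signs of a member of \<^term>\<open>G d\<close> are never \<^const>\<open>M\<close>, so on the support of the first
  signed set the order forces equality of labels. This equality also puts the coordinate in the
  support of the second, since outside it the label is \<^const>\<open>M\<close>.\<close>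

lemma preceq_to_P_iff:
  assumes "(J, \<tau>) \<in> G d" and "(I, \<sigma>) \<in> G d"
  shows "preceq d (to_P d (J, \<tau>)) (to_P d (I, \<sigma>)) \<longleftrightarrow> J \<subseteq> I \<and> restrict \<sigma> J = \<tau>"
proof -
  have J: "J \<subseteq> {1..d}" and \<tau>: "\<tau> \<in> J \<rightarrow>\<^sub>E {L, U}"
    using assms(1) by (auto simp: G_def)
  have sign: "\<tau> i \<noteq> M" if "i \<in> J" for i
    using PiE_mem[OF \<tau> that] by auto
  have "preceq d (to_P d (J, \<tau>)) (to_P d (I, \<sigma>)) \<longleftrightarrow> (\<forall>i\<in>J. i \<in> I \<and> \<sigma> i = \<tau> i)"
    using J sign by (auto simp: preceq_def to_P_def less_eq_label_def split: if_splits)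
  also have "\<dots> \<longleftrightarrow> J \<subseteq> I \<and> (\<forall>i\<in>J. \<sigma> i = \<tau> i)"
    by blast
  also have "(\<forall>i\<in>J. \<sigma> i = \<tau> i) \<longleftrightarrow> restrict \<sigma> J = \<tau>"
    using PiE_arb[OF \<tau>] by (auto simp: fun_eq_iff restrict_def)
  finally show ?thesis .
qed

lemma witness_matrix_eq_zeta:
  assumes "g \<in> G d" and "h \<in> G d"
  shows "witness_matrix g h = zeta (preceq d) (to_P d g) (to_P d h)"
  using assms preceq_to_P_iff
  by (cases g; cases h) (simp add: witness_matrix_def zeta_def)

lemma bij_betw_of_P: "bij_betw (of_P d) (P_times d) (G d)"
  unfolding of_P_def by (rule bij_betw_inv_into[OF bij_betw_to_P])

lemma to_P_of_P: "x \<in> P_times d \<Longrightarrow> to_P d (of_P d x) = x"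
  unfolding of_P_def by (rule bij_betw_inv_into_right[OF bij_betw_to_P])

lemma matrix_on_P_witness_matrix:
  assumes "x \<in> P_times d" and "y \<in> P_times d"
  shows "matrix_on_P d witness_matrix x y = zeta (preceq d) x y"
  using assms bij_betwE[OF bij_betw_of_P]
  by (simp add: matrix_on_P_def witness_matrix_eq_zeta[of _ d] to_P_of_P)

lemma finite_P_times: "finite (P_times d)"
proof -
  have "(UNIV :: label set) = {M, L, U}"
    using label.exhaust by blast
  then have "finite (UNIV :: label set)"
    by (metis finite.emptyI finite.insertI)
  then show ?thesis
    by (simp add: P_times_def P_def finite_PiE)
qed

lemma fun_on_P_tail_family:
  assumes "x \<in> P_times d"
  shows "fun_on_P d (tail_family d w) x =
    (\<Sum>y\<in>{y \<in> P_times d. preceq d x y}. fun_on_P d w y)"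
proof -
  have "fun_on_P d (tail_family d w) x =
      (\<Sum>y\<in>P_times d. matrix_on_P d witness_matrix x y * fun_on_P d w y)"
    unfolding fun_on_P_def tail_family_def matrix_on_P_def
    by (rule sum.reindex_bij_betw[OF bij_betw_of_P, symmetric])
  also have "\<dots> = (\<Sum>y\<in>P_times d. if preceq d x y then fun_on_P d w y else 0)"
    using assms by (intro sum.cong) (simp_all add: matrix_on_P_witness_matrix zeta_def)
  also have "\<dots> = (\<Sum>y\<in>{y \<in> P_times d. preceq d x y}. fun_on_P d w y)"
    by (rule sum.inter_filter[OF finite_P_times, symmetric])
  finally show ?thesis .
qed

theorem proposition18:
  fixes d :: nat
  assumes "d \<ge> 1"
  shows "(\<forall>x\<in>P_times d. \<forall>y\<in>P_times d.
            matrix_on_P d witness_matrix x y = zeta (preceq d) x y) \<and>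
         (\<forall>w :: signed_set \<Rightarrow> real. \<forall>x\<in>P_times d.
            fun_on_P d (tail_family d w) x =
              (\<Sum>y\<in>{y \<in> P_times d. preceq d x y}. fun_on_P d w y))"
  using matrix_on_P_witness_matrix fun_on_P_tail_family by blast

end
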